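(* Let $f(X)=(X-1)^5$ and $g(X)=\prod_{j=1}^5\left(X-e^{2\pi i\beta_j}\right)$ with $\beta_5=\frac12$ and $(\beta_1,\beta_2,\beta_3,\beta_4)$ one of the following $14$ tuples: $\left(\frac16,\frac16,\frac56,\frac56\right)$, $\left(\frac12,\frac12,\frac12,\frac12\right)$, $\left(\frac13,\frac13,\frac23,\frac23\right)$, $\left(\frac12,\frac12,\frac13,\frac23\right)$, $\left(\frac14,\frac14,\frac34,\frac34\right)$, $\left(\frac12,\frac12,\frac14,\frac34\right)$, $\left(\frac13,\frac23,\frac14,\frac34\right)$, $\left(\frac15,\frac25,\frac35,\frac45\right)$, $\left(\frac12,\frac12,\frac16,\frac56\right)$, $\left(\frac13,\frac23,\frac16,\frac56\right)$, $\left(\frac14,\frac34,\frac16,\frac56\right)$, $\left(\frac18,\frac38,\frac58,\frac78\right)$, $\left(\frac1{10},\frac3{10},\frac7{10},\frac9{10}\right)$, $\left(\frac1{12},\frac5{12},\frac7{12},\frac{11}{12}\right)$. Let $\mathrm{Q}$ be the non-degenerate integral quadratic form (unique up to scalar) preserved by the hypergeometric group $\Gamma(f,g)$. Then in each of these $14$ cases the orthogonal group $\mathrm{O}_{\mathrm{Q}}$ has $\mathbb{Q}$-rank $2$.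
   Context: For a monic polynomial $p(X)=X^5+c_4X^4+c_3X^3+c_2X^2+c_1X+c_0$, the companion matrix of $p$ is the $5\times5$ matrix sending the standard basis vector $e_i$ to $e_{i+1}$ for $1\le i\le 4$ and $e_5$ to $-c_0e_1-c_1e_2-c_2e_3-c_3e_4-c_4e_5$ (matrices act on column vectors). The polynomials $g$ in question have integer coefficients and $g(0)=1$. The hypergeometric group $\Gamma(f,g)$ is the subgroup of $\mathrm{GL}_5(\mathbb{Z})$ generated by the companion matrices $A$ of $f$ and $B$ of $g$. By Beukers–Heckman it preserves a non-degenerate integral quadratic form $\mathrm{Q}$ on $\mathbb{Z}^5$, unique up to scalar, and is Zariski dense in the orthogonal group $\mathrm{O}_{\mathrm{Q}}$. The $\mathbb{Q}$-rank of $\mathrm{O}_{\mathrm{Q}}$ is the dimension of a maximal $\mathbb{Q}$-split torus, equivalently the maximal dimension of a totally isotropic subspace of $(\mathbb{Q}^5,\mathrm{Q})$; so $\mathbb{Q}$-rank $2$ means that this maximal dimension is $2$. *)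

theory Defs
  imports
    "HOL-Analysis.Analysis"
    "HOL-Algebra.Generated_Groups"
    "HOL-Computational_Algebra.Polynomial"
begin

(* The index type 5 plays the role of {1, ..., 5}; its element 5 is the same as 0.
   Both the literal indices and the library function "vector" count 1, 2, 3, 4, 5.
   The rows are listed, so the k-th column is the image of the k-th basis vector,
   see companion5_axis below. *)
definition companion5 :: "'a::comm_ring_1 poly \<Rightarrow> 'a^5^5" where
  "companion5 p = vector
     [vector [0, 0, 0, 0, - coeff p 0],
      vector [1, 0, 0, 0, - coeff p 1],
      vector [0, 1, 0, 0, - coeff p 2],
      vector [0, 0, 1, 0, - coeff p 3],
      vector [0, 0, 0, 1, - coeff p 4]]"

lemma exhaust_5:
  fixes x :: 5
  shows "x = 1 \<or> x = 2 \<or> x = 3 \<or> x = 4 \<or> x = 5"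
proof (induct x)
  case (of_int z)
  then have "0 \<le> z" and "z < 5" by simp_all
  then have "z = 0 \<or> z = 1 \<or> z = 2 \<or> z = 3 \<or> z = 4" by arith
  then show ?case by auto
qed

lemma forall_5: "(\<forall>i::5. P i) \<longleftrightarrow> P 1 \<and> P 2 \<and> P 3 \<and> P 4 \<and> P 5"
  by (metis exhaust_5)

lemma UNIV_5: "UNIV = {1::5, 2::5, 3::5, 4::5, 5::5}"
  using exhaust_5 by auto

lemma sum_5: "sum f (UNIV::5 set) = f 1 + f 2 + f 3 + f 4 + f 5"
  unfolding UNIV_5 by (simp add: ac_simps)

lemma vector_5 [simp]:
  "(vector [a, b, c, d, e] :: 'a::zero^5) $ 1 = a"
  "(vector [a, b, c, d, e] :: 'a::zero^5) $ 2 = b"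
  "(vector [a, b, c, d, e] :: 'a::zero^5) $ 3 = c"
  "(vector [a, b, c, d, e] :: 'a::zero^5) $ 4 = d"
  "(vector [a, b, c, d, e] :: 'a::zero^5) $ 5 = e"
  by (simp_all add: vector_def)

lemma companion5_axis:
  "companion5 p *v axis 1 1 = axis 2 1"
  "companion5 p *v axis 2 1 = axis 3 1"
  "companion5 p *v axis 3 1 = axis 4 1"
  "companion5 p *v axis 4 1 = axis 5 1"
  "companion5 p *v axis 5 1 =
     vector [- coeff p 0, - coeff p 1, - coeff p 2, - coeff p 3, - coeff p 4]"
  by (simp_all add: companion5_def matrix_vector_mult_def vec_eq_iff forall_5 sum_5 axis_def)

definition GL :: "('a::comm_ring_1^'n^'n) monoid" where
  "GL = \<lparr>carrier = {M. invertible M}, mult = (**), one = mat 1\<rparr>"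

definition hypergeometric_group :: "int poly \<Rightarrow> int poly \<Rightarrow> (int^5^5) set" where
  "hypergeometric_group f g = generate GL {companion5 f, companion5 g}"

definition polar_form :: "('a::field^'n \<Rightarrow> 'a) \<Rightarrow> 'a^'n \<Rightarrow> 'a^'n \<Rightarrow> 'a" where
  "polar_form Q x y = Q (x + y) - Q x - Q y"

(* Linearity of the polar form in one argument suffices, as it is symmetric. *)
definition quadratic_form :: "('a::field^'n \<Rightarrow> 'a) \<Rightarrow> bool" where
  "quadratic_form Q \<longleftrightarrow>
     (\<forall>c x. Q (c *s x) = c\<^sup>2 * Q x) \<and>
     (\<forall>x. Vector_Spaces.linear (*s) (*) (polar_form Q x))"

definition nondegenerate_form :: "('a::field^'n \<Rightarrow> 'a) \<Rightarrow> bool" where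
  "nondegenerate_form Q \<longleftrightarrow> (\<forall>x. (\<forall>y. polar_form Q x y = 0) \<longrightarrow> x = 0)"

(* An integral form on Z^n is given by its unique extension to Q^n; integrality says that
   the extension maps Z^n to Z, i.e. that the coefficients of the form are integers. *)
definition integral_form :: "(rat^'n \<Rightarrow> rat) \<Rightarrow> bool" where
  "integral_form Q \<longleftrightarrow> (\<forall>x. (\<forall>i. x $ i \<in> \<int>) \<longrightarrow> Q x \<in> \<int>)"

definition preserves_form :: "(int^'n^'n) set \<Rightarrow> (rat^'n \<Rightarrow> rat) \<Rightarrow> bool" where
  "preserves_form \<Gamma> Q \<longleftrightarrow> (\<forall>M\<in>\<Gamma>. \<forall>x. Q (map_matrix of_int M *v x) = Q x)"

definition totally_isotropic :: "('a::field^'n \<Rightarrow> 'a) \<Rightarrow> ('a^'n) set \<Rightarrow> bool" where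
  "totally_isotropic Q W \<longleftrightarrow> vec.subspace W \<and> (\<forall>x\<in>W. Q x = 0)"

(* The Q-rank of the orthogonal group of a non-degenerate form Q over the rationals: the
   maximal dimension of a totally isotropic subspace, which equals the dimension of a
   maximal Q-split torus of that group. *)
definition orthogonal_group_Q_rank :: "(rat^'n \<Rightarrow> rat) \<Rightarrow> nat" where
  "orthogonal_group_Q_rank Q = Max {vec.dim W | W. totally_isotropic Q W}"

(* The tuples (beta_1, ..., beta_4); the last parameter beta_5 = 1/2 is not included. *)
definition beta_tuples :: "real list set" where
  "beta_tuples =
    {[1/6, 1/6, 5/6, 5/6],
     [1/2, 1/2, 1/2, 1/2],
     [1/3, 1/3, 2/3, 2/3],
     [1/2, 1/2, 1/3, 2/3],
     [1/4, 1/4, 3/4, 3/4],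
     [1/2, 1/2, 1/4, 3/4],
     [1/3, 2/3, 1/4, 3/4],
     [1/5, 2/5, 3/5, 4/5],
     [1/2, 1/2, 1/6, 5/6],
     [1/3, 2/3, 1/6, 5/6],
     [1/4, 3/4, 1/6, 5/6],
     [1/8, 3/8, 5/8, 7/8],
     [1/10, 3/10, 7/10, 9/10],
     [1/12, 5/12, 7/12, 11/12]}"

end

theory Submission
  imports Defs
begin

text \<open>
  The companion matrix \<open>A\<close> of \<open>(X - 1)\<^sup>5\<close> is similar to a single unipotent Jordan block, so
  \<open>N = A - 1\<close> satisfies \<open>N\<^sup>5 = 0 \<noteq> N\<^sup>4\<close>.  Invariance of the form under
  \<open>A\<close> makes the adjoint of \<open>N\<close> equal to \<open>-A\<^sup>-\<^sup>1N\<close>, whence \<open>N\<^sup>i V\<close> is orthogonal to \<open>N\<^sup>j V\<close> as soon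
  as \<open>i + j \<ge> 5\<close>.  In particular \<open>N\<^sup>3 V\<close> is totally isotropic, and as it contains the independent
  vectors \<open>N\<^sup>3 e\<^sub>1\<close> and \<open>N\<^sup>4 e\<^sub>1\<close>, the rank is at least \<open>2\<close>
  (\<open>totally_isotropic_range_of_unipotent\<close>).
  Conversely, a totally isotropic subspace of a nondegenerate space has at most half the dimension
  of the whole space (\<open>dim_totally_isotropic_le\<close>), hence dimension at most \<open>2\<close> here.
\<close>

section \<open>The polar form is bilinear\<close>

lemma polar_form_commute: "polar_form Q x y = polar_form Q y x"
  by (simp add: polar_form_def add.commute)

context
  fixes Q :: "'a::field^'n \<Rightarrow> 'a"
  assumes Q: "quadratic_form Q"
begin

lemma linear_polar_form: "Vector_Spaces.linear (*s) (*) (polar_form Q x)"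
  using Q by (simp add: quadratic_form_def)

lemma polar_form_add_right: "polar_form Q x (y + z) = polar_form Q x y + polar_form Q x z"
  by (rule Modules.module_hom.add[OF linear_polar_form[of x, folded module_hom_iff_linear]])

lemma polar_form_scale_right: "polar_form Q x (c *s y) = c * polar_form Q x y"
  by (rule Modules.module_hom.scale[OF linear_polar_form[of x, folded module_hom_iff_linear]])

lemma polar_form_zero_right: "polar_form Q x 0 = 0"
  using polar_form_scale_right[of x 0 0] by simp

lemma polar_form_add_left: "polar_form Q (x + y) z = polar_form Q x z + polar_form Q y z"
  by (metis polar_form_commute polar_form_add_right)

lemma polar_form_scale_left: "polar_form Q (c *s x) y = c * polar_form Q x y"
  by (metis polar_form_commute polar_form_scale_right)

lemma polar_form_self: "polar_form Q x x = 2 * Q x"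
proof -
  have "Q (2 *s x) = 2\<^sup>2 * Q x"
    using Q by (simp add: quadratic_form_def)
  moreover have "2 *s x = x + x"
    by (simp add: vec_eq_iff)
  ultimately show ?thesis
    by (simp add: polar_form_def power2_eq_square)
qed

end

section \<open>Totally isotropic subspaces have at most half the dimension\<close>

text \<open>
  For \<open>w\<close> in an isotropic \<open>W\<close>, the functional \<open>polar_form Q w\<close> kills a basis \<open>B\<close> of \<open>W\<close>, so it is
  determined by its values on the vectors \<open>C - B\<close> that complete \<open>B\<close> to a basis of the whole space.
  Nondegeneracy makes \<open>w\<close> recoverable from them, so \<open>W\<close> embeds into a space of dimension
  \<open>card (C - B)\<close>, the codimension of \<open>W\<close>.
\<close>
lemma dim_totally_isotropic_le:
  fixes Q :: "'a::field^'n \<Rightarrow> 'a"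
  assumes Q: "quadratic_form Q" and nd: "nondegenerate_form Q" and W: "totally_isotropic Q W"
  shows "2 * vec.dim W \<le> CARD('n)"
proof -
  have sub: "vec.subspace W" and iso: "\<And>x. x \<in> W \<Longrightarrow> Q x = 0"
    using W by (auto simp: totally_isotropic_def)
  have orth: "polar_form Q x y = 0" if "x \<in> W" "y \<in> W" for x y
    using that iso vec.subspace_add[OF sub] by (simp add: polar_form_def)
  obtain B where B: "B \<subseteq> W" "vec.independent B" "W \<subseteq> vec.span B" "card B = vec.dim W"
    using vec.basis_exists by blast
  define C where "C = vec.extend_basis B"
  have C: "B \<subseteq> C" "vec.independent C" "vec.span C = UNIV"
    using B(2) by (simp_all add: C_def vec.extend_basis_superset vec.independent_extend_basis)
  have finC: "finite C"
    using C(2) by (rule vec.finiteI_independent)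
  have cardC: "card C = CARD('n)"
    using vec.dim_eq_card[of C UNIV] C by (simp add: card_cart_basis)
  define \<phi> where "\<phi> w = (\<Sum>c\<in>C - B. polar_form Q w c *s c)" for w
  have lin: "Vector_Spaces.linear (*s) (*s) \<phi>"
    unfolding \<phi>_def
    by (rule vec.linear_compose_sum)
       (simp add: Vector_Spaces.linear_iff vec.vector_space_axioms polar_form_add_left[OF Q] polar_form_scale_left[OF Q]
          vec.scale_left_distrib)
  have "x = 0" if "x \<in> W" "\<phi> x = 0" for x
  proof -
    have "polar_form Q x c = 0" if "c \<in> C - B" for c
      using vec.independentD[OF C(2), of "C - B" "polar_form Q x" c] finC that \<open>\<phi> x = 0\<close>
      by (auto simp: \<phi>_def)
    moreover have "polar_form Q x c = 0" if "c \<in> B" for c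
      using orth \<open>x \<in> W\<close> B(1) that by blast
    ultimately have "polar_form Q x c = 0" if "c \<in> C" for c
      using that by blast
    then have "polar_form Q x y = 0" for y
      using Modules.module_hom.eq_0_on_span[OF linear_polar_form[OF Q, folded module_hom_iff_linear]] C(3) by blast
    then show ?thesis
      using nd by (simp add: nondegenerate_form_def)
  qed
  then have inj: "inj_on \<phi> (vec.span W)"
    using vec.linear_inj_on_iff_eq_0[OF lin sub] sub by (metis vec.span_eq_iff)
  have "\<phi> ` W \<subseteq> vec.span (C - B)"
    unfolding \<phi>_def by (blast intro: vec.span_sum vec.span_scale vec.span_base)
  then have "vec.dim (\<phi> ` W) \<le> card (C - B)"
    using finC by (intro vec.dim_le_card) auto
  moreover have "vec.dim (\<phi> ` W) = vec.dim W"
    using lin inj by (rule vec.dim_image_eq)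
  ultimately show ?thesis
    using B(4) C(1) finC cardC by (simp add: card_Diff_subset finite_subset card_mono)
qed

text \<open>
  The upper bound keeps the set of dimensions finite, so that the maximum in the
  definition of the rank is a genuine one.
\<close>
lemma orthogonal_group_Q_rank_eqI:
  fixes Q :: "rat^'n \<Rightarrow> rat"
  assumes "totally_isotropic Q W" "r \<le> vec.dim W"
    and upper: "\<And>U. totally_isotropic Q U \<Longrightarrow> vec.dim U \<le> r"
  shows "orthogonal_group_Q_rank Q = r"
  unfolding orthogonal_group_Q_rank_def
proof (rule Max_eqI)
  show "finite {vec.dim U |U. totally_isotropic Q U}"
    by (rule finite_subset[of _ "{..r}"]) (auto simp: upper)
  show "r \<in> {vec.dim U |U. totally_isotropic Q U}"
    using assms(1,2) upper[OF assms(1)] by (auto intro!: exI[of _ W])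
qed (use upper in auto)

section \<open>Isotropic subspaces from unipotent isometries\<close>

text \<open>
  Expanding \<open>polar_form Q (A x) (A y) = polar_form Q x y\<close> with \<open>A = 1 + N\<close> gives
  \<open>\<langle>N x, y\<rangle> = - \<langle>x, N y\<rangle> - \<langle>N x, N y\<rangle>\<close>.  Both terms on the right have one more \<open>N\<close> on the second
  argument without lowering the total exponent below \<open>m\<close>, so the claim follows by descending
  induction on \<open>j\<close>, starting from \<open>N\<^sup>m = 0\<close>.
\<close>
lemma polar_form_unipotent_filtration:
  fixes A :: "'a::field^'n^'n"
  defines "N \<equiv> (*v) (A - mat 1)"
  assumes Q: "quadratic_form Q" and isometry: "\<And>x. Q (A *v x) = Q x"
    and nilpotent: "\<And>x. (N ^^ m) x = 0" and "m \<le> i + j" "j \<le> m"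
  shows "polar_form Q ((N ^^ i) x) ((N ^^ j) y) = 0"
  using \<open>j \<le> m\<close> \<open>m \<le> i + j\<close>
proof (induction j arbitrary: i rule: inc_induct)
  case base
  then show ?case
    by (simp add: nilpotent polar_form_zero_right[OF Q])
next
  case (step j)
  have A: "A *v u = u + N u" for u
    by (simp add: N_def matrix_vector_mult_diff_rdistrib)
  have polar_A: "polar_form Q (A *v u) (A *v v) = polar_form Q u v" for u v
    by (simp add: polar_form_def isometry flip: matrix_vector_right_distrib)
  have adjoint: "polar_form Q (N u) v = - polar_form Q u (N v) - polar_form Q (N u) (N v)" for u v
    using polar_A[of u v]
    by (simp add: A polar_form_add_left[OF Q] polar_form_add_right[OF Q] algebra_simps
          eq_neg_iff_add_eq_0)
  obtain l where l: "i = Suc l"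
    using step.hyps step.prems by (cases i) auto
  have "polar_form Q ((N ^^ l) x) (N ((N ^^ j) y)) = 0"
    using step.IH[of l] step.prems l by simp
  moreover have "polar_form Q (N ((N ^^ l) x)) (N ((N ^^ j) y)) = 0"
    using step.IH[of "Suc l"] step.prems l by simp
  ultimately show ?case
    using adjoint[of "(N ^^ l) x" "(N ^^ j) y"] l by simp
qed

lemma totally_isotropic_range_of_unipotent:
  fixes A :: "'a::field_char_0^'n^'n"
  defines "N \<equiv> (*v) (A - mat 1)"
  assumes Q: "quadratic_form Q" and isometry: "\<And>x. Q (A *v x) = Q x"
    and nilpotent: "\<And>x. (N ^^ m) x = 0" and "m \<le> 2 * k" "k \<le> m"
  shows "totally_isotropic Q (range (N ^^ k))"
proof -
  have "Vector_Spaces.linear (*s) (*s) (N ^^ k)"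
  proof (induction k)
    case 0
    then show ?case
      by (simp add: id_def vec.linear_ident)
  next
    case (Suc k)
    then show ?case
      using Vector_Spaces.linear_compose matrix_vector_mul_linear_gen[of "A - mat 1"]
      unfolding N_def funpow.simps by blast
  qed
  then have "vec.subspace (range (N ^^ k))"
    by (intro vec.linear_subspace_image) simp_all
  moreover have "Q ((N ^^ k) x) = 0" for x
    using polar_form_unipotent_filtration[OF Q isometry, of m k k x x] nilpotent assms(5,6)
    by (simp add: N_def polar_form_self[OF Q])
  ultimately show ?thesis
    by (auto simp: totally_isotropic_def)
qed

section \<open>The companion matrix of the fifth power of X - 1\<close>

lemma map_matrix_companion5:
  "map_matrix of_int (companion5 p) = companion5 (map_poly of_int p)"
  by (simp add: map_matrix_def companion5_def vec_eq_iff forall_5 coeff_map_poly)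

lemma companion5_unipotent_mult:
  fixes x :: "'a::field^5"
  shows "(companion5 ([:-1, 1:] ^ 5) - mat 1) *v x = vector
    [x $ 5 - x $ 1, x $ 1 - x $ 2 - 5 * x $ 5, x $ 2 - x $ 3 + 10 * x $ 5,
     x $ 3 - x $ 4 - 10 * x $ 5, x $ 4 + 4 * x $ 5]"
  by (simp add: companion5_def matrix_vector_mult_def vec_eq_iff forall_5 sum_5 mat_def
        eval_nat_numeral algebra_simps)

text \<open>
  Applying \<open>A - 1\<close> repeatedly to the cyclic vector \<open>e\<^sub>1\<close> produces the coefficients of the powers of
  \<open>X - 1\<close>: the vectors in the lower bound are those of \<open>(X - 1)\<^sup>3\<close> and \<open>(X - 1)\<^sup>4\<close>, which are
  independent because the degrees differ.
\<close>
lemma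
  fixes N :: "'a::field^5 \<Rightarrow> 'a^5"
  defines "N \<equiv> (*v) (companion5 ([:-1, 1:] ^ 5) - mat 1)"
  shows companion5_unipotent_nilpotent: "(N ^^ 5) x = 0"
    and dim_range_companion5_unipotent_cubed: "2 \<le> vec.dim (range (N ^^ 3))"
proof -
  note N = companion5_unipotent_mult[where 'a='a, folded N_def]
  show "(N ^^ 5) x = 0"
    by (simp add: N eval_nat_numeral vec_eq_iff forall_5)
  define a b where "a = (N ^^ 3) (axis 1 1)" and "b = (N ^^ 3) (N (axis 1 1))"
  have a: "a = vector [-1, 3, -3, 1, 0]" and b: "b = vector [1, -4, 6, -4, 1]"
    by (simp_all add: a_def b_def N eval_nat_numeral
          vec_eq_iff forall_5 axis_def)
  have "a \<notin> vec.span {b}"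
  proof
    assume "a \<in> vec.span {b}"
    then obtain c where "a = c *s b"
      by (auto simp: vec.span_singleton)
    then have "a $ 5 = c * b $ 5" "a $ 4 = c * b $ 4"
      by simp_all
    then show False
      by (simp add: a b)
  qed
  moreover have "b \<noteq> 0"
    by (auto simp: b vec_eq_iff forall_5)
  ultimately have "vec.independent {a, b}" and "a \<noteq> b"
    using vec.span_base[of b "{b}"] by (auto simp: vec.independent_insert)
  then show "2 \<le> vec.dim (range (N ^^ 3))"
    using vec.independent_card_le_dim[of "{a, b}" "range (N ^^ 3)"] by (auto simp: a_def b_def)
qed

theorem proposition2p3:
  fixes f g :: "int poly" and \<beta> :: "real list" and Q :: "rat^5 \<Rightarrow> rat"
  assumes "f = [:-1, 1:] ^ 5"
    and "\<beta> \<in> beta_tuples"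
    and "map_poly of_int g =
           (\<Prod>b\<leftarrow>\<beta> @ [1/2]. [:- exp (2 * complex_of_real pi * \<i> * complex_of_real b), 1:])"
    and "quadratic_form Q"
    and "integral_form Q"
    and "nondegenerate_form Q"
    and "preserves_form (hypergeometric_group f g) Q"
  shows "orthogonal_group_Q_rank Q = 2"
proof (rule orthogonal_group_Q_rank_eqI)
  let ?A = "companion5 ([:-1, 1:] ^ 5) :: rat^5^5"
  have "map_poly of_int ([:-1, 1:] ^ 5) = ([:-1, 1:] ^ 5 :: rat poly)"
    by (simp add: eval_nat_numeral map_poly_pCons)
  then have "map_matrix of_int (companion5 f) = ?A"
    by (simp add: map_matrix_companion5 assms(1))
  moreover have "companion5 f \<in> hypergeometric_group f g"
    by (auto simp: hypergeometric_group_def intro: generate.incl)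
  ultimately have isometry: "Q (?A *v x) = Q x" for x
    using assms(7) unfolding preserves_form_def by metis
  show "totally_isotropic Q (range (((*v) (?A - mat 1)) ^^ 3))"
    by (rule totally_isotropic_range_of_unipotent[OF assms(4) isometry
          companion5_unipotent_nilpotent]) simp_all
  show "2 \<le> vec.dim (range (((*v) (?A - mat 1)) ^^ 3))"
    by (rule dim_range_companion5_unipotent_cubed)
  show "vec.dim U \<le> 2" if "totally_isotropic Q U" for U
    using dim_totally_isotropic_le[OF assms(4,6) that] by simp
qed

end
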